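(* Let $\sigma>0$, $\epsilon\in(0,1)$ and $\delta\in(0,1]$. For the AWGN channel $Y_i=X_i+Z_i$, $i=1,\ldots,n$, where the $Z_i$ are i.i.d. centered Gaussian random variables with standard deviation $\sigma$, independent of the input, the covert capacity $L_{\epsilon,\delta}$ under average error probability $\epsilon$ and Kullback-Leibler covertness level $\delta$ satisfies $$L_{\epsilon,\delta}\leq \frac{\sqrt{\delta}}{1-\epsilon}.$$
   Context: All logarithms are natural. Fix $\sigma>0$. The AWGN channel of blocklength $n$ maps an input $x^n\in\mathbb{R}^n$ to the output $Y^n=x^n+Z^n$, where $Z^n=(Z_1,\ldots,Z_n)$ has i.i.d. components that are Gaussian with mean $0$ and standard deviation $\sigma$ (variance $\sigma^2$), independent of the input; $P_{Y^n|X^n}(\cdot|x^n)$ denotes the law of $x^n+Z^n$ and $P_{Z^n}$ the law of $Z^n$. The legitimate receiver and the eavesdropper observe the same output $Y^n$. A code $\mathcal{C}=(f,g)$ of length $n$ for a finite nonempty message set $\mathcal{M}$ and a finite nonempty key set $\mathcal{K}$ consists of an encoder $f\colon\mathcal{M}\times\mathcal{K}\to\mathbb{R}^n$ and a (measurable) decoder $g\colon\mathbb{R}^n\times\mathcal{K}\to\mathcal{M}$. Several pairs $(w,k)$ may be mapped to the same codeword. The message and the key are independent and uniformly distributed; the key is known to the transmitter and the receiver but not to the eavesdropper. The size of $\mathcal{K}$ is unconstrained (it may be taken as large as needed). The average error probability is $$P_e^{\mathrm{avg}}=\frac{1}{|\mathcal{K}||\mathcal{M}|}\sum_{k\in\mathcal{K}}\sum_{w\in\mathcal{M}}\mathbb{P}\left[g(f(w,k)+Z^n,k)\neq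 w\right].$$ The output distribution induced by the code is $$P_{Y^n_{\mathcal{C}}}(\cdot)=\frac{1}{|\mathcal{K}||\mathcal{M}|}\sum_{k\in\mathcal{K}}\sum_{w\in\mathcal{M}}P_{Y^n|X^n}(\cdot|f(w,k)).$$ The Kullback-Leibler divergence is $D(P_1\|P_2)=\int \ln\left(\frac{dP_1}{dP_2}\right)dP_1$. An $(n,M,\epsilon,\delta)$-code is a code of length $n$ with $|\mathcal{M}|=M$ (and some finite key set) such that $P_e^{\mathrm{avg}}\leq\epsilon$ and $D(P_{Y^n_{\mathcal{C}}}\|P_{Z^n})\leq\delta$. Let $$M^*(n,\epsilon,\delta)=\max\{M : \text{there exists an }(n,M,\epsilon,\delta)\text{-code}\}.$$ The covert capacity is $$L_{\epsilon,\delta}=\liminf_{n\to+\infty}\frac{\ln\left(M^*(n,\epsilon,\delta)\right)}{\sqrt{n}}.$$ *)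

theory Defs
  imports "HOL-Probability.Probability"
begin

abbreviation Rn :: "nat \<Rightarrow> (nat \<Rightarrow> real) measure" where
  "Rn n \<equiv> Pi\<^sub>M {..<n} (\<lambda>_. borel)"

definition noise :: "real \<Rightarrow> nat \<Rightarrow> (nat \<Rightarrow> real) measure" where
  "noise \<sigma> n = Pi\<^sub>M {..<n} (\<lambda>_. density lborel (normal_density 0 \<sigma>))"

definition vec_plus :: "nat \<Rightarrow> (nat \<Rightarrow> real) \<Rightarrow> (nat \<Rightarrow> real) \<Rightarrow> nat \<Rightarrow> real" where
  "vec_plus n x z = (\<lambda>i\<in>{..<n}. x i + z i)"

definition awgn :: "real \<Rightarrow> nat \<Rightarrow> (nat \<Rightarrow> real) \<Rightarrow> (nat \<Rightarrow> real) measure" where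
  "awgn \<sigma> n x = distr (noise \<sigma> n) (Rn n) (vec_plus n x)"

text \<open>Codes are pairs \<open>(f, g)\<close> with a finite message set \<open>W\<close> and a finite key set \<open>K\<close>. Since \<open>K\<close> is
  discrete, joint measurability of \<open>g\<close> just says that every \<open>\<lambda>y. g (y, k)\<close> is measurable.\<close>

definition is_code ::
  "nat \<Rightarrow> 'w set \<Rightarrow> 'k set \<Rightarrow> ('w \<times> 'k \<Rightarrow> nat \<Rightarrow> real) \<Rightarrow> ((nat \<Rightarrow> real) \<times> 'k \<Rightarrow> 'w) \<Rightarrow> bool" where
  "is_code n W K f g \<longleftrightarrow>
     finite W \<and> W \<noteq> {} \<and> finite K \<and> K \<noteq> {} \<and>
     f \<in> W \<times> K \<rightarrow> space (Rn n) \<and>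
     g \<in> measurable (Rn n \<Otimes>\<^sub>M count_space K) (count_space W)"

definition avg_error ::
  "real \<Rightarrow> nat \<Rightarrow> 'w set \<Rightarrow> 'k set \<Rightarrow> ('w \<times> 'k \<Rightarrow> nat \<Rightarrow> real) \<Rightarrow> ((nat \<Rightarrow> real) \<times> 'k \<Rightarrow> 'w) \<Rightarrow> real" where
  "avg_error \<sigma> n W K f g =
     1 / (real (card K) * real (card W)) *
     (\<Sum>k\<in>K. \<Sum>w\<in>W. measure (noise \<sigma> n)
        {z \<in> space (noise \<sigma> n). g (vec_plus n (f (w, k)) z, k) \<noteq> w})"

definition output_dist ::
  "real \<Rightarrow> nat \<Rightarrow> 'w set \<Rightarrow> 'k set \<Rightarrow> ('w \<times> 'k \<Rightarrow> nat \<Rightarrow> real) \<Rightarrow> (nat \<Rightarrow> real) measure" where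
  "output_dist \<sigma> n W K f =
     measure_of (space (Rn n)) (sets (Rn n))
       (\<lambda>A. ennreal (1 / (real (card K) * real (card W))) *
            (\<Sum>k\<in>K. \<Sum>w\<in>W. emeasure (awgn \<sigma> n (f (w, k))) A))"

lemma space_output_dist [simp]: "space (output_dist \<sigma> n W K f) = space (Rn n)"
  by (simp add: output_dist_def sets.space_closed)

lemma sets_output_dist [simp]: "sets (output_dist \<sigma> n W K f) = sets (Rn n)"
  by (simp add: output_dist_def sets.space_closed)

lemma emeasure_output_dist:
  assumes A: "A \<in> sets (Rn n)"
  shows "emeasure (output_dist \<sigma> n W K f) A =
    ennreal (1 / (real (card K) * real (card W))) *
    (\<Sum>k\<in>K. \<Sum>w\<in>W. emeasure (awgn \<sigma> n (f (w, k))) A)"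
  unfolding output_dist_def
proof (rule emeasure_measure_of_sigma)
  show "sigma_algebra (space (Rn n)) (sets (Rn n))"
    by (rule sets.sigma_algebra_axioms)
  let ?\<mu> = "\<lambda>A. ennreal (1 / (real (card K) * real (card W))) *
    (\<Sum>k\<in>K. \<Sum>w\<in>W. emeasure (awgn \<sigma> n (f (w, k))) A)"
  show "positive (sets (Rn n)) ?\<mu>"
    by (simp add: positive_def)
  show "countably_additive (sets (Rn n)) ?\<mu>"
  proof (rule countably_additiveI)
    fix B :: "nat \<Rightarrow> (nat \<Rightarrow> real) set"
    assume B: "range B \<subseteq> sets (Rn n)" "disjoint_family B"
    have "(\<Sum>i. emeasure (awgn \<sigma> n x) (B i)) = emeasure (awgn \<sigma> n x) (\<Union> (range B))" for x
      using B by (intro suminf_emeasure) (auto simp: awgn_def)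
    then show "(\<Sum>i. ?\<mu> (B i)) = ?\<mu> (\<Union> (range B))"
      by (simp add: suminf_sum)
  qed
qed (rule A)

text \<open>In the library, \<open>KL_divergence b P\<^sub>2 P\<^sub>1\<close> is the integral of the base-\<open>b\<close> logarithm of
  \<open>dP\<^sub>1 / dP\<^sub>2\<close> with respect to \<open>P\<^sub>1\<close>, so the reference measure comes first. A finite mixture of
  shifted Gaussians has a positive density with respect to the noise, and the logarithm of this density is
  integrable, so neither the junk value of \<open>RN_deriv\<close> nor that of the integral occurs below.\<close>

definition is_covert_code ::
  "real \<Rightarrow> nat \<Rightarrow> nat \<Rightarrow> real \<Rightarrow> real \<Rightarrow> 'w set \<Rightarrow> 'k set \<Rightarrow>
   ('w \<times> 'k \<Rightarrow> nat \<Rightarrow> real) \<Rightarrow> ((nat \<Rightarrow> real) \<times> 'k \<Rightarrow> 'w) \<Rightarrow> bool" where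
  "is_covert_code \<sigma> n M \<epsilon> \<delta> W K f g \<longleftrightarrow>
     is_code n W K f g \<and> card W = M \<and>
     avg_error \<sigma> n W K f g \<le> \<epsilon> \<and>
     KL_divergence (exp 1) (noise \<sigma> n) (output_dist \<sigma> n W K f) \<le> \<delta>"

text \<open>Any finite message and key sets can be relabelled by natural numbers. The set of achievable sizes
  contains 1 (constant zero codeword) and, for \<open>\<sigma> > 0\<close> and \<open>0 < \<epsilon> < 1\<close>, is bounded: the divergence
  constraint bounds the power of the code, so Fano's inequality bounds \<open>M\<close>. Hence \<open>Max\<close> is meaningful.\<close>

definition M_star :: "real \<Rightarrow> nat \<Rightarrow> real \<Rightarrow> real \<Rightarrow> nat" where
  "M_star \<sigma> n \<epsilon> \<delta> =
     Max {M. \<exists>(W :: nat set) (K :: nat set) f g. is_covert_code \<sigma> n M \<epsilon> \<delta> W K f g}"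

definition covert_capacity :: "real \<Rightarrow> real \<Rightarrow> real \<Rightarrow> ereal" where
  "covert_capacity \<sigma> \<epsilon> \<delta> =
     liminf (\<lambda>n. ereal (ln (real (M_star \<sigma> n \<epsilon> \<delta>)) / sqrt (real n)))"

end

theory Submission
  imports Defs
begin

text \<open>Let \<open>u\<close> be the average power of the code divided by \<open>n * \<sigma>\<^sup>2\<close> and let \<open>Q\<close> be the centered
  Gaussian law with variance \<open>\<sigma>\<^sup>2 * (1 + u)\<close>. Since \<open>D(P_Y || Q) \<ge> 0\<close>, the divergence \<open>D(P_Y || P_Z)\<close> is
  at least the mean of \<open>ln (dQ / dP_Z)\<close> under \<open>P_Y\<close>, which is \<open>n/2 * (u - ln (1 + u))\<close>. On the other
  hand the mean of \<open>D(P_{Y|X} || Q)\<close> over the codewords is \<open>n/2 * ln (1 + u)\<close>, and under \<open>Q\<close> the output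
  is independent of the message, so a decoder succeeds with probability at most \<open>1/M\<close>; hence
  \<open>(1 - \<epsilon>) * ln M \<le> n/2 * ln (1 + u) + 1\<close>. Covertness forces \<open>n/2 * ln (1 + u) \<le> sqrt (\<delta> * n)\<close>.\<close>

section \<open>A summation identity and Gibbs' inequality\<close>

lemma sum_Times_swap: "(\<Sum>j\<in>A \<times> B. h j) = (\<Sum>b\<in>B. \<Sum>a\<in>A. h (a, b))"
  by (subst sum.swap) (simp add: sum.cartesian_product)

text \<open>Integrates \<open>ln t <= t - 1\<close> at \<open>t = r x / p x\<close>; where
  \<open>p\<close> vanishes the pointwise claim is just \<open>- r x <= 0\<close>. Keeping both
  masses makes the inequality valid for an \<open>r\<close> that is not normalized, as in
  \<open>shift_density_test_bound\<close>.\<close>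

lemma gibbs_inequality:
  fixes p r :: "'a \<Rightarrow> real"
  assumes nonneg: "\<And>x. x \<in> space M \<Longrightarrow> 0 \<le> p x" and pos: "\<And>x. x \<in> space M \<Longrightarrow> 0 < r x"
    and int: "integrable M p" "integrable M r"
      "integrable M (\<lambda>x. p x * ln (p x))" "integrable M (\<lambda>x. p x * ln (r x))"
  shows "(\<integral>x. p x * ln (r x) \<partial>M) + (\<integral>x. p x \<partial>M) - (\<integral>x. r x \<partial>M) \<le> (\<integral>x. p x * ln (p x) \<partial>M)"
proof -
  have "p x * ln (r x) + p x - r x \<le> p x * ln (p x)" if "x \<in> space M" for x
  proof (cases "p x = 0")
    case True
    with pos[OF that] show ?thesis by simp
  next
    case False
    with nonneg[OF that] have "0 < p x" by simp
    with pos[OF that] have "p x * (ln (r x) - ln (p x)) \<le> p x * (r x / p x - 1)"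
      using ln_le_minus_one[of "r x / p x"] by (intro mult_left_mono) (simp_all add: ln_div)
    with \<open>0 < p x\<close> show ?thesis by (simp add: algebra_simps)
  qed
  then have "(\<integral>x. p x * ln (r x) + p x - r x \<partial>M) \<le> (\<integral>x. p x * ln (p x) \<partial>M)"
    using int by (intro integral_mono) auto
  with int show ?thesis by simp
qed

section \<open>Gaussian noise and its translates as product measures\<close>

locale gaussian_noise =
  fixes \<sigma> :: real and n :: nat
  assumes sigma_pos: "0 < \<sigma>"
begin

abbreviation N1 :: "real measure" where
  "N1 \<equiv> density lborel (normal_density 0 \<sigma>)"

sublocale N1: prob_space N1
  using sigma_pos by (rule prob_space_normal_density)

sublocale prod: product_prob_space "\<lambda>_ :: nat. N1" "{..<n}"
  by unfold_locales

sublocale noise: prob_space "noise \<sigma> n"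
  unfolding noise_def by (rule prod.P.prob_space_axioms)

lemma sets_noise [measurable_cong]: "sets (noise \<sigma> n) = sets (Rn n)"
  unfolding noise_def by (intro sets_PiM_cong) auto

lemma space_noise: "space (noise \<sigma> n) = space (Rn n)"
  by (rule sets_eq_imp_space_eq[OF sets_noise])

lemma measurable_vec_plus [measurable]: "vec_plus n x \<in> measurable (noise \<sigma> n) (Rn n)"
  unfolding vec_plus_def by measurable

lemma sets_awgn [measurable_cong]: "sets (awgn \<sigma> n x) = sets (Rn n)"
  by (simp add: awgn_def)

lemma distr_N1_shift: "distr N1 borel (\<lambda>z. a + z) = density lborel (normal_density a \<sigma>)"
proof -
  have "distributed N1 lborel (\<lambda>x. x) (normal_density 0 \<sigma>)"
    by (simp add: distributed_def distr_id2)
  then have "distributed N1 lborel (\<lambda>x. a + 1 * x) (normal_density (a + 1 * 0) (\<bar>1\<bar> * \<sigma>))"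
    by (intro N1.normal_density_affine sigma_pos) auto
  from distributed_distr_eq_density[OF this] show ?thesis
    by (simp add: distr_cong[OF refl sets_lborel[symmetric] refl])
qed

text \<open>A translation acts on the coordinates separately, so the preimage of a box is a box with
  translated sides, and boxes determine a product measure.\<close>

lemma awgn_eq_PiM: "awgn \<sigma> n x = Pi\<^sub>M {..<n} (\<lambda>i. density lborel (normal_density (x i) \<sigma>))"
proof -
  interpret shifted: product_prob_space "\<lambda>i. density lborel (normal_density (x i) \<sigma>)" "{..<n}"
    using sigma_pos
    by (intro product_prob_spaceI) (rule prob_space_normal_density)
  show ?thesis
  proof (rule shifted.PiM_eqI)
    show "sets (awgn \<sigma> n x) = sets (Pi\<^sub>M {..<n} (\<lambda>i. density lborel (normal_density (x i) \<sigma>)))"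
      unfolding sets_awgn by (intro sets_PiM_cong) auto
  next
    fix A :: "nat \<Rightarrow> real set"
    assume A: "i \<in> {..<n} \<Longrightarrow> A i \<in> sets (density lborel (normal_density (x i) \<sigma>))" for i
    then have A': "\<And>i. i < n \<Longrightarrow> A i \<in> sets borel" by simp
    have box: "Pi\<^sub>E {..<n} A \<in> sets (Rn n)"
      using A' by (intro sets_PiM_I_finite) auto
    have pre: "vec_plus n x -` Pi\<^sub>E {..<n} A \<inter> space (noise \<sigma> n)
        = Pi\<^sub>E {..<n} (\<lambda>i. (\<lambda>z. x i + z) -` A i)"
      by (auto simp: vec_plus_def space_noise space_PiM PiE_iff)
    have meas: "(\<lambda>z. x i + z) -` A i \<in> sets N1" if "i < n" for i
      using measurable_sets[of "\<lambda>z. x i + z" borel borel "A i"] A'[OF that] by simp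
    have "emeasure (awgn \<sigma> n x) (Pi\<^sub>E {..<n} A)
        = emeasure (Pi\<^sub>M {..<n} (\<lambda>_. N1)) (Pi\<^sub>E {..<n} (\<lambda>i. (\<lambda>z. x i + z) -` A i))"
      unfolding awgn_def emeasure_distr[OF measurable_vec_plus box] pre by (simp only: noise_def)
    also have "\<dots> = (\<Prod>i<n. emeasure N1 ((\<lambda>z. x i + z) -` A i))"
      by (rule prod.emeasure_PiM) (auto simp: meas[simplified])
    also have "\<dots> = (\<Prod>i<n. emeasure (density lborel (normal_density (x i) \<sigma>)) (A i))"
    proof (intro prod.cong refl)
      fix i assume "i \<in> {..<n}"
      then show "emeasure N1 ((\<lambda>z. x i + z) -` A i)
          = emeasure (density lborel (normal_density (x i) \<sigma>)) (A i)"
        using A'[of i] emeasure_distr[of "\<lambda>z. x i + z" N1 borel "A i"]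
        unfolding distr_N1_shift by simp
    qed
    finally show "emeasure (awgn \<sigma> n x) (Pi\<^sub>E {..<n} A)
        = (\<Prod>i<n. emeasure (density lborel (normal_density (x i) \<sigma>)) (A i))" .
  qed simp
qed

section \<open>Likelihood ratio of a translate and change of measure\<close>

text \<open>The likelihood ratio of the law of \<open>x + Z\<close> against the noise (the
  finite-dimensional Cameron-Martin formula). Its logarithm is affine in \<open>z\<close>.\<close>

definition shift_density :: "(nat \<Rightarrow> real) \<Rightarrow> (nat \<Rightarrow> real) \<Rightarrow> real" where
  "shift_density x z = exp (\<Sum>i<n. (2 * x i * z i - (x i)\<^sup>2) / (2 * \<sigma>\<^sup>2))"

lemma measurable_shift_density [measurable]: "shift_density x \<in> borel_measurable (Rn n)"
  unfolding shift_density_def by measurable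

lemma shift_density_pos: "0 < shift_density x z"
  by (simp add: shift_density_def)

lemma normal_density_shift:
  "normal_density 0 \<sigma> z * exp ((2 * a * z - a\<^sup>2) / (2 * \<sigma>\<^sup>2)) = normal_density a \<sigma> z"
  using sigma_pos
  by (simp add: normal_density_def exp_add[symmetric] add_divide_distrib[symmetric] power2_eq_square algebra_simps)

text \<open>The likelihood ratio times the indicator of a box is a product of functions of single
  coordinates, so its integral factorizes; in each factor, completing the square moves the mean from
  0 to \<open>x i\<close>. This is the product measure of \<open>awgn_eq_PiM\<close>.\<close>

lemma awgn_eq_density: "awgn \<sigma> n x = density (noise \<sigma> n) (shift_density x)"
proof -
  interpret shifted: product_prob_space "\<lambda>i. density lborel (normal_density (x i) \<sigma>)" "{..<n}"
    using sigma_pos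
    by (intro product_prob_spaceI) (rule prob_space_normal_density)
  have "density (noise \<sigma> n) (shift_density x)
      = Pi\<^sub>M {..<n} (\<lambda>i. density lborel (normal_density (x i) \<sigma>))"
  proof (rule shifted.PiM_eqI)
    show "sets (density (noise \<sigma> n) (shift_density x))
        = sets (Pi\<^sub>M {..<n} (\<lambda>i. density lborel (normal_density (x i) \<sigma>)))"
      unfolding sets_density sets_noise by (intro sets_PiM_cong) auto
  next
    fix A :: "nat \<Rightarrow> real set"
    assume A: "i \<in> {..<n} \<Longrightarrow> A i \<in> sets (density lborel (normal_density (x i) \<sigma>))" for i
    then have A': "\<And>i. i < n \<Longrightarrow> A i \<in> sets borel" by simp
    have box: "Pi\<^sub>E {..<n} A \<in> sets (noise \<sigma> n)"
      unfolding sets_noise using A' by (intro sets_PiM_I_finite) auto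
    let ?h = "\<lambda>i z. ennreal (exp ((2 * x i * z - (x i)\<^sup>2) / (2 * \<sigma>\<^sup>2))) * indicator (A i) z"
    have eq: "ennreal (shift_density x z) * indicator (Pi\<^sub>E {..<n} A) z = (\<Prod>i<n. ?h i (z i))"
      if z: "z \<in> space (noise \<sigma> n)" for z
    proof -
      have "(\<Prod>i<n. indicator (A i) (z i) :: ennreal) = indicator (Pi\<^sub>E {..<n} A) z"
        using z by (auto simp: space_noise space_PiM PiE_iff indicator_def prod_zero_iff)
      then show ?thesis
        by (simp add: shift_density_def exp_sum prod_ennreal[symmetric] prod.distrib)
    qed
    have "emeasure (density (noise \<sigma> n) (shift_density x)) (Pi\<^sub>E {..<n} A)
        = (\<integral>\<^sup>+ z. (\<Prod>i<n. ?h i (z i)) \<partial>noise \<sigma> n)"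
      using box by (subst emeasure_density) (auto intro!: nn_integral_cong eq)
    also have "\<dots> = (\<Prod>i<n. \<integral>\<^sup>+ z. ?h i z \<partial>N1)"
      unfolding noise_def using A' by (intro prod.product_nn_integral_prod) auto
    also have "\<dots> = (\<Prod>i<n. emeasure (density lborel (normal_density (x i) \<sigma>)) (A i))"
      using A'
      by (intro prod.cong refl)
        (simp add: emeasure_density nn_integral_density mult.assoc[symmetric] ennreal_mult[symmetric] normal_density_shift)
    finally show "emeasure (density (noise \<sigma> n) (shift_density x)) (Pi\<^sub>E {..<n} A)
        = (\<Prod>i<n. emeasure (density lborel (normal_density (x i) \<sigma>)) (A i))" .
  qed simp
  then show ?thesis by (simp add: awgn_eq_PiM)
qed

text \<open>The channel law is both an image of the noise and a density against it. Comparing the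
  two turns integrals weighted by the likelihood ratio into expectations at the shifted
  point.\<close>

lemma integrable_shift_density_mult_iff:
  assumes [measurable]: "F \<in> borel_measurable (Rn n)"
  shows "integrable (noise \<sigma> n) (\<lambda>z. shift_density x z * F z)
    \<longleftrightarrow> integrable (noise \<sigma> n) (\<lambda>z. F (vec_plus n x z))"
proof -
  have "integrable (awgn \<sigma> n x) F \<longleftrightarrow> integrable (noise \<sigma> n) (\<lambda>z. F (vec_plus n x z))"
    unfolding awgn_def by (rule integrable_distr_eq) measurable
  then show ?thesis
    unfolding awgn_eq_density
    by (subst (asm) integrable_real_density) (auto simp: shift_density_pos less_imp_le)
qed

lemma integral_shift_density_mult:
  fixes F :: "(nat \<Rightarrow> real) \<Rightarrow> real"
  assumes [measurable]: "F \<in> borel_measurable (Rn n)"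
  shows "(\<integral>z. shift_density x z * F z \<partial>noise \<sigma> n) = (\<integral>z. F (vec_plus n x z) \<partial>noise \<sigma> n)"
proof -
  have "(\<integral>z. F z \<partial>awgn \<sigma> n x) = (\<integral>z. F (vec_plus n x z) \<partial>noise \<sigma> n)"
    unfolding awgn_def by (rule integral_distr) measurable
  then show ?thesis
    unfolding awgn_eq_density
    by (subst (asm) integral_real_density) (auto simp: shift_density_pos less_imp_le)
qed

lemma integrable_shift_density: "integrable (noise \<sigma> n) (shift_density x)"
  using integrable_shift_density_mult_iff[of "\<lambda>_. 1" x] by simp

lemma integral_shift_density: "(\<integral>z. shift_density x z \<partial>noise \<sigma> n) = 1"
  using integral_shift_density_mult[of "\<lambda>_. 1" x] by (simp add: noise.prob_space)

text \<open>The cross term of the completed square does not depend on \<open>z\<close>. Products of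
  likelihood ratios are therefore integrable, which makes the mixture density square
  integrable.\<close>

lemma shift_density_mult:
  "shift_density x z * shift_density y z
    = exp (\<Sum>i<n. x i * y i / \<sigma>\<^sup>2) * shift_density (\<lambda>i. x i + y i) z"
proof -
  have "(\<Sum>i<n. (2 * x i * z i - (x i)\<^sup>2) / (2 * \<sigma>\<^sup>2)) + (\<Sum>i<n. (2 * y i * z i - (y i)\<^sup>2) / (2 * \<sigma>\<^sup>2))
      = (\<Sum>i<n. x i * y i / \<sigma>\<^sup>2) + (\<Sum>i<n. (2 * (x i + y i) * z i - (x i + y i)\<^sup>2) / (2 * \<sigma>\<^sup>2))"
    unfolding sum.distrib[symmetric] using sigma_pos
    by (intro sum.cong refl) (simp add: field_simps power2_eq_square)
  then show ?thesis by (simp add: shift_density_def exp_add[symmetric])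
qed

lemma integrable_shift_density_mult:
  "integrable (noise \<sigma> n) (\<lambda>z. shift_density x z * shift_density y z)"
  unfolding shift_density_mult by (intro integrable_mult_right integrable_shift_density)

section \<open>Moments of a single noise coordinate\<close>

lemma has_bochner_integral_noise_component:
  assumes "i < n" "has_bochner_integral N1 (h :: real \<Rightarrow> real) c"
  shows "has_bochner_integral (noise \<sigma> n) (\<lambda>z. h (z i)) c"
proof -
  have distr: "distr (noise \<sigma> n) N1 (\<lambda>z. z i) = N1"
    unfolding noise_def using assms(1) by (intro prod.PiM_component) simp
  have meas: "(\<lambda>z. z i) \<in> measurable (noise \<sigma> n) N1"
    using assms(1) by (auto simp: noise_def)
  have "h \<in> borel_measurable N1"
    using assms(2) by (auto simp: has_bochner_integral_iff)
  from integrable_distr_eq[OF meas this] integral_distr[OF meas this] assms(2) show ?thesis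
    by (simp add: has_bochner_integral_iff distr)
qed

lemma N1_first_moment: "has_bochner_integral N1 (\<lambda>z. z) 0"
  using normal_moment_nz_1[OF sigma_pos, of 0]
  by (intro has_bochner_integral_density) auto

lemma N1_second_moment: "has_bochner_integral N1 (\<lambda>z. z\<^sup>2) (\<sigma>\<^sup>2)"
  using normal_moment_even[OF sigma_pos, of 0 1]
  by (intro has_bochner_integral_density) auto

section \<open>The Gaussian law of larger variance\<close>

text \<open>The likelihood ratio \<open>dQ/dP_Z\<close> for the centered Gaussian \<open>Q\<close>
  with variance \<open>\<sigma>\<^sup>2 * (1 + u)\<close> in each coordinate.\<close>

definition wide_density :: "real \<Rightarrow> (nat \<Rightarrow> real) \<Rightarrow> real" where
  "wide_density u z = exp (\<Sum>i<n. u * (z i)\<^sup>2 / (2 * \<sigma>\<^sup>2 * (1 + u)) - ln (1 + u) / 2)"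

lemma measurable_wide_density [measurable]: "wide_density u \<in> borel_measurable (Rn n)"
  unfolding wide_density_def by measurable

lemma wide_density_pos: "0 < wide_density u z"
  by (simp add: wide_density_def)

lemma normal_density_widen:
  assumes "0 \<le> u"
  shows "normal_density 0 \<sigma> z * exp (u * z\<^sup>2 / (2 * \<sigma>\<^sup>2 * (1 + u)) - ln (1 + u) / 2)
    = normal_density 0 (\<sigma> * sqrt (1 + u)) z"
proof -
  have half: "exp (ln (1 + u) / 2) = sqrt (1 + u)"
    using assms by (simp add: ln_sqrt[symmetric])
  have var: "(\<sigma> * sqrt (1 + u))\<^sup>2 = \<sigma>\<^sup>2 * (1 + u)"
    using assms by (simp add: power_mult_distrib)
  have root: "sqrt (2 * pi * (\<sigma>\<^sup>2 * (1 + u))) = sqrt (2 * pi * \<sigma>\<^sup>2) * sqrt (1 + u)"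
    by (simp only: real_sqrt_mult mult.assoc)
  \<comment> \<open>Uses \<open>u / (1 + u) = 1 - 1 / (1 + u)\<close>. The remaining term
    \<open>ln (1 + u) / 2\<close> is the ratio of the normalizing constants.\<close>
  have "- z\<^sup>2 / (2 * \<sigma>\<^sup>2) + u * z\<^sup>2 / (2 * \<sigma>\<^sup>2 * (1 + u)) = - z\<^sup>2 / (2 * (\<sigma>\<^sup>2 * (1 + u)))"
    using assms sigma_pos by (simp add: divide_simps) (simp add: algebra_simps)
  then have "exp (- z\<^sup>2 / (2 * (\<sigma>\<^sup>2 * (1 + u))))
      = exp (- z\<^sup>2 / (2 * \<sigma>\<^sup>2)) * exp (u * z\<^sup>2 / (2 * \<sigma>\<^sup>2 * (1 + u)))"
    by (simp only: exp_add[symmetric])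
  then show ?thesis
    unfolding normal_density_def var root exp_diff half diff_zero by simp
qed

lemma has_bochner_integral_wide_density:
  assumes "0 \<le> u"
  shows "has_bochner_integral (noise \<sigma> n) (wide_density u) 1"
proof (rule has_bochner_integral_nn_integral)
  let ?h = "\<lambda>z. ennreal (exp (u * z\<^sup>2 / (2 * \<sigma>\<^sup>2 * (1 + u)) - ln (1 + u) / 2))"
  interpret wide: prob_space "density lborel (normal_density 0 (\<sigma> * sqrt (1 + u)))"
    using assms sigma_pos by (intro prob_space_normal_density) simp
  have "(\<integral>\<^sup>+ z. wide_density u z \<partial>noise \<sigma> n) = (\<integral>\<^sup>+ z. (\<Prod>i<n. ?h (z i)) \<partial>noise \<sigma> n)"
    by (simp add: wide_density_def exp_sum prod_ennreal)
  also have "\<dots> = (\<Prod>i<n. \<integral>\<^sup>+ z. ?h z \<partial>N1)"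
    unfolding noise_def by (intro prod.product_nn_integral_prod) auto
  also have "(\<integral>\<^sup>+ z. ?h z \<partial>N1) = (\<integral>\<^sup>+ z. normal_density 0 (\<sigma> * sqrt (1 + u)) z \<partial>lborel)"
    by (simp add: nn_integral_density ennreal_mult[symmetric] normal_density_widen[OF assms])
  also have "\<dots> = 1"
    using wide.emeasure_space_1 by (simp add: emeasure_density)
  finally show "(\<integral>\<^sup>+ z. wide_density u z \<partial>noise \<sigma> n) = ennreal 1" by simp
qed (auto simp: wide_density_pos less_imp_le)

lemma integrable_wide_density: "0 \<le> u \<Longrightarrow> integrable (noise \<sigma> n) (wide_density u)"
  and integral_wide_density: "0 \<le> u \<Longrightarrow> (\<integral>z. wide_density u z \<partial>noise \<sigma> n) = 1"
  using has_bochner_integral_wide_density by (auto simp: has_bochner_integral_iff)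

text \<open>The logarithm depends on \<open>z\<close> only through its energy, so its mean under a
  code sees only the average power of the codewords.\<close>

lemma ln_wide_density:
  "ln (wide_density u z) = u / (2 * \<sigma>\<^sup>2 * (1 + u)) * (\<Sum>i<n. (z i)\<^sup>2) - real n / 2 * ln (1 + u)"
  by (simp add: wide_density_def sum_subtractf sum_distrib_left)

section \<open>Expected log-likelihood ratios for a given codeword\<close>

lemma has_bochner_integral_noise_const: "has_bochner_integral (noise \<sigma> n) (\<lambda>_. c :: real) c"
  using noise.prob_space by (simp add: has_bochner_integral_iff)

lemma vec_plus_first_moment:
  assumes "i < n"
  shows "has_bochner_integral (noise \<sigma> n) (\<lambda>z. vec_plus n x z i) (x i)"
proof -
  have "has_bochner_integral (noise \<sigma> n) (\<lambda>z. x i + z i) (x i + 0)"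
    by (intro has_bochner_integral_add has_bochner_integral_noise_const
        has_bochner_integral_noise_component[OF assms] N1_first_moment)
  with assms show ?thesis by (simp add: vec_plus_def)
qed

lemma vec_plus_second_moment:
  assumes "i < n"
  shows "has_bochner_integral (noise \<sigma> n) (\<lambda>z. (vec_plus n x z i)\<^sup>2) ((x i)\<^sup>2 + \<sigma>\<^sup>2)"
proof -
  have "has_bochner_integral (noise \<sigma> n) (\<lambda>z. (x i)\<^sup>2 + 2 * x i * z i + (z i)\<^sup>2)
      ((x i)\<^sup>2 + 2 * x i * 0 + \<sigma>\<^sup>2)"
    by (intro has_bochner_integral_add has_bochner_integral_mult_right has_bochner_integral_noise_const
        has_bochner_integral_noise_component[OF assms, where h = "\<lambda>t. t"]
        has_bochner_integral_noise_component[OF assms, where h = "\<lambda>t. t\<^sup>2"]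
        N1_first_moment N1_second_moment)
  with assms show ?thesis by (simp add: vec_plus_def power2_sum algebra_simps)
qed

lemma has_bochner_integral_shift_density_mult:
  assumes "F \<in> borel_measurable (Rn n)"
    and "has_bochner_integral (noise \<sigma> n) (\<lambda>z. F (vec_plus n x z)) c"
  shows "has_bochner_integral (noise \<sigma> n) (\<lambda>z. shift_density x z * F z) c"
  using assms(2)
  by (simp add: has_bochner_integral_iff integrable_shift_density_mult_iff[OF assms(1)]
      integral_shift_density_mult[OF assms(1)])

text \<open>This is \<open>D(P_{Y|X=x} || P_Z)\<close>: under the shifted law coordinate
  \<open>i\<close> has mean \<open>x i\<close>, so the affine exponent averages to
  \<open>(2 * x i * x i - (x i)\<^sup>2) / (2 * \<sigma>\<^sup>2)\<close>.\<close>

lemma shift_density_ln_shift_density: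
  "has_bochner_integral (noise \<sigma> n) (\<lambda>z. shift_density x z * ln (shift_density x z))
    ((\<Sum>i<n. (x i)\<^sup>2) / (2 * \<sigma>\<^sup>2))"
proof (rule has_bochner_integral_shift_density_mult)
  have "has_bochner_integral (noise \<sigma> n)
      (\<lambda>z. \<Sum>i<n. (2 * x i * vec_plus n x z i - (x i)\<^sup>2) / (2 * \<sigma>\<^sup>2))
      (\<Sum>i<n. (2 * x i * x i - (x i)\<^sup>2) / (2 * \<sigma>\<^sup>2))"
    by (intro has_bochner_integral_sum has_bochner_integral_divide has_bochner_integral_diff
        has_bochner_integral_mult_right has_bochner_integral_noise_const vec_plus_first_moment) auto
  then show "has_bochner_integral (noise \<sigma> n) (\<lambda>z. ln (shift_density x (vec_plus n x z)))
      ((\<Sum>i<n. (x i)\<^sup>2) / (2 * \<sigma>\<^sup>2))"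
    by (simp add: shift_density_def power2_eq_square sum_divide_distrib)
qed measurable

text \<open>Under the shifted law coordinate \<open>i\<close> has second moment
  \<open>(x i)\<^sup>2 + \<sigma>\<^sup>2\<close>. Subtracting this value from that of
  \<open>shift_density_ln_shift_density\<close> gives \<open>D(P_{Y|X=x} || Q)\<close>.\<close>

lemma shift_density_ln_wide_density:
  "has_bochner_integral (noise \<sigma> n) (\<lambda>z. shift_density x z * ln (wide_density u z))
    (u / (2 * \<sigma>\<^sup>2 * (1 + u)) * ((\<Sum>i<n. (x i)\<^sup>2) + real n * \<sigma>\<^sup>2) - real n / 2 * ln (1 + u))"
proof (rule has_bochner_integral_shift_density_mult)
  have "has_bochner_integral (noise \<sigma> n)
      (\<lambda>z. u / (2 * \<sigma>\<^sup>2 * (1 + u)) * (\<Sum>i<n. (vec_plus n x z i)\<^sup>2) - real n / 2 * ln (1 + u))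
      (u / (2 * \<sigma>\<^sup>2 * (1 + u)) * (\<Sum>i<n. (x i)\<^sup>2 + \<sigma>\<^sup>2) - real n / 2 * ln (1 + u))"
    by (intro has_bochner_integral_sum has_bochner_integral_diff
        has_bochner_integral_mult_right has_bochner_integral_noise_const vec_plus_second_moment) auto
  then show "has_bochner_integral (noise \<sigma> n) (\<lambda>z. ln (wide_density u (vec_plus n x z)))
      (u / (2 * \<sigma>\<^sup>2 * (1 + u)) * ((\<Sum>i<n. (x i)\<^sup>2) + real n * \<sigma>\<^sup>2) - real n / 2 * ln (1 + u))"
    by (simp add: ln_wide_density sum.distrib)
qed measurable

section \<open>Mixtures of shifted Gaussians and relative entropy bounds\<close>

text \<open>For a code, \<open>J\<close> is the set of message-key pairs. Indexing by pairs instead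
  of codewords counts a repeated codeword with its multiplicity.\<close>

definition mixture_density :: "'j set \<Rightarrow> ('j \<Rightarrow> nat \<Rightarrow> real) \<Rightarrow> (nat \<Rightarrow> real) \<Rightarrow> real" where
  "mixture_density J x z = 1 / real (card J) * (\<Sum>j\<in>J. shift_density (x j) z)"

lemma measurable_mixture_density [measurable]: "mixture_density J x \<in> borel_measurable (Rn n)"
  unfolding mixture_density_def by measurable

lemma mixture_density_nonneg: "0 \<le> mixture_density J x z"
  by (simp add: mixture_density_def sum_nonneg shift_density_pos less_imp_le)

lemma integrable_mixture_density_mult:
  assumes "\<And>j. j \<in> J \<Longrightarrow> integrable (noise \<sigma> n) (\<lambda>z. shift_density (x j) z * F z)"
  shows "integrable (noise \<sigma> n) (\<lambda>z. mixture_density J x z * F z)"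
  unfolding mixture_density_def mult.assoc sum_distrib_right
  using assms by (intro integrable_mult_right Bochner_Integration.integrable_sum)

lemma integral_mixture_density_mult:
  fixes F :: "(nat \<Rightarrow> real) \<Rightarrow> real"
  assumes "\<And>j. j \<in> J \<Longrightarrow> integrable (noise \<sigma> n) (\<lambda>z. shift_density (x j) z * F z)"
  shows "(\<integral>z. mixture_density J x z * F z \<partial>noise \<sigma> n)
    = 1 / real (card J) * (\<Sum>j\<in>J. \<integral>z. shift_density (x j) z * F z \<partial>noise \<sigma> n)"
  unfolding mixture_density_def mult.assoc sum_distrib_right
  using assms by (subst integral_mult_right_zero) simp

lemma integrable_mixture_density: "integrable (noise \<sigma> n) (mixture_density J x)"
  using integrable_mixture_density_mult[of J x "\<lambda>_. 1"] integrable_shift_density by simp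

lemma integral_mixture_density:
  assumes "finite J" "J \<noteq> {}"
  shows "(\<integral>z. mixture_density J x z \<partial>noise \<sigma> n) = 1"
  using assms integral_mixture_density_mult[of J x "\<lambda>_. 1"]
  by (simp add: integrable_shift_density integral_shift_density)

text \<open>The mixture density is square integrable by \<open>shift_density_mult\<close>, and
  \<open>t * ln t\<close> is at most \<open>1 + t * t\<close> in absolute value for
  \<open>t >= 0\<close>. So the divergence is a genuine integral, not a default value.\<close>

lemma integrable_mixture_density_ln:
  "integrable (noise \<sigma> n) (\<lambda>z. mixture_density J x z * ln (mixture_density J x z))"
proof (rule Bochner_Integration.integrable_bound)
  have "mixture_density J x z * shift_density (x j) z
      = 1 / real (card J) * (\<Sum>i\<in>J. shift_density (x i) z * shift_density (x j) z)" for j z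
    by (simp add: mixture_density_def sum_distrib_right)
  then have "integrable (noise \<sigma> n) (\<lambda>z. mixture_density J x z * shift_density (x j) z)" for j
    by (simp only:) (intro integrable_mult_right Bochner_Integration.integrable_sum integrable_shift_density_mult)
  then have "integrable (noise \<sigma> n) (\<lambda>z. mixture_density J x z * mixture_density J x z)"
    by (intro integrable_mixture_density_mult) (simp add: mult.commute)
  then show "integrable (noise \<sigma> n) (\<lambda>z. 1 + mixture_density J x z * mixture_density J x z)"
    by simp
next
  have "\<bar>t * ln t\<bar> \<le> 1 + t * t" if "0 \<le> t" for t :: real
  proof (cases "t = 0")
    case False
    with that have t: "0 < t" by simp
    have "t * ln t \<le> t * t"
      using t by (intro mult_left_mono) (auto intro: ln_bound)
    moreover have "t * ln (1 / t) \<le> t * (1 / t)"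
      using t by (intro mult_left_mono ln_bound) auto
    then have "- (t * ln t) \<le> 1"
      using t by (simp add: ln_div)
    moreover have "0 \<le> t * t" by simp
    ultimately show ?thesis unfolding abs_le_iff by linarith
  qed simp
  then show "AE z in noise \<sigma> n. norm (mixture_density J x z * ln (mixture_density J x z))
      \<le> norm (1 + mixture_density J x z * mixture_density J x z)"
    by (simp add: mixture_density_nonneg abs_mult)
qed measurable

text \<open>Gibbs' inequality with the mixture density as \<open>p\<close> and
  \<open>wide_density u\<close> as \<open>r\<close>. The power hypothesis makes the mean output
  energy per coordinate equal to the variance of \<open>Q\<close>, so the quadratic part of
  \<open>ln (dQ/dP_Z)\<close> contributes exactly \<open>n * u / 2\<close>.\<close>

lemma mixture_relative_entropy_ge:
  assumes "finite J" "J \<noteq> {}" "0 \<le> u"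
    and power: "(\<Sum>j\<in>J. \<Sum>i<n. (x j i)\<^sup>2) = real (card J) * (real n * \<sigma>\<^sup>2 * u)"
  shows "real n / 2 * (u - ln (1 + u))
    \<le> (\<integral>z. mixture_density J x z * ln (mixture_density J x z) \<partial>noise \<sigma> n)"
proof -
  have J: "0 < real (card J)" using assms by (simp add: card_gt_0_iff)
  define c where "c = u / (2 * \<sigma>\<^sup>2 * (1 + u))"
  have c: "c * (\<sigma>\<^sup>2 * (1 + u)) = u / 2"
    using sigma_pos assms(3) by (simp add: c_def divide_simps)
  note wide = shift_density_ln_wide_density[of _ u, folded c_def, unfolded has_bochner_integral_iff]
  have "(\<integral>z. mixture_density J x z * ln (wide_density u z) \<partial>noise \<sigma> n)
      = 1 / real (card J) * (\<Sum>j\<in>J. c * ((\<Sum>i<n. (x j i)\<^sup>2) + real n * \<sigma>\<^sup>2) - real n / 2 * ln (1 + u))"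
    using wide by (subst integral_mixture_density_mult) auto
  also have "(\<Sum>j\<in>J. c * ((\<Sum>i<n. (x j i)\<^sup>2) + real n * \<sigma>\<^sup>2) - real n / 2 * ln (1 + u))
      = c * (real (card J) * (real n * \<sigma>\<^sup>2 * u) + real (card J) * (real n * \<sigma>\<^sup>2))
        - real (card J) * (real n / 2 * ln (1 + u))"
    by (simp add: sum_subtractf sum_distrib_left[symmetric] sum.distrib power)
  also have "\<dots> = (c * (\<sigma>\<^sup>2 * (1 + u))) * (real (card J) * real n)
      - real (card J) * (real n / 2 * ln (1 + u))"
    by (simp add: algebra_simps)
  also have "\<dots> = real (card J) * (real n / 2 * (u - ln (1 + u)))"
    unfolding c by (simp add: algebra_simps)
  finally have "(\<integral>z. mixture_density J x z * ln (wide_density u z) \<partial>noise \<sigma> n)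
      = real n / 2 * (u - ln (1 + u))"
    using J by simp
  moreover have "integrable (noise \<sigma> n) (\<lambda>z. mixture_density J x z * ln (wide_density u z))"
    using wide by (intro integrable_mixture_density_mult) auto
  ultimately show ?thesis
    using gibbs_inequality[of "noise \<sigma> n" "mixture_density J x" "wide_density u"]
    by (simp add: mixture_density_nonneg wide_density_pos integrable_mixture_density
        integrable_mixture_density_ln integrable_wide_density integral_mixture_density
        integral_wide_density assms)
qed

text \<open>The variational bound is tested against the function \<open>ln m\<close> times the indicator of \<open>A\<close>; averaged over
  the codewords, with \<open>A\<close> the decoding region, it replaces Fano's inequality.\<close>

lemma shift_density_test_bound:
  assumes "0 \<le> u" "1 \<le> m" and A [measurable]: "A \<in> sets (Rn n)"
  shows "ln m * measure (awgn \<sigma> n x) A - (m - 1) * (\<integral>z. wide_density u z * indicator A z \<partial>noise \<sigma> n)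
    \<le> (\<Sum>i<n. (x i)\<^sup>2) / (2 * \<sigma>\<^sup>2)
      - u / (2 * \<sigma>\<^sup>2 * (1 + u)) * ((\<Sum>i<n. (x i)\<^sup>2) + real n * \<sigma>\<^sup>2) + real n / 2 * ln (1 + u)"
proof -
  note wide = shift_density_ln_wide_density[of x u, unfolded has_bochner_integral_iff]
  note shift = shift_density_ln_shift_density[of x, unfolded has_bochner_integral_iff]
  \<comment> \<open>Scaling by \<open>m\<close> on \<open>A\<close> adds \<open>ln m\<close> to the
    logarithm there and \<open>(m - 1) * Q(A)\<close> to the total mass. Gibbs' inequality against
    \<open>?r\<close> then leaves \<open>D(P_{Y|X=x} || Q)\<close> on the right.\<close>
  let ?r = "\<lambda>z. wide_density u z + (m - 1) * (wide_density u z * indicator A z)"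
  have A': "A \<in> sets (noise \<sigma> n)" by (simp add: sets_noise)
  have int_wide: "integrable (noise \<sigma> n) (\<lambda>z. wide_density u z * indicator A z)"
    using integrable_wide_density[OF assms(1)] A' by (intro integrable_real_mult_indicator)
  have int_shift: "integrable (noise \<sigma> n) (\<lambda>z. shift_density x z * indicator A z)"
    using integrable_shift_density A' by (intro integrable_real_mult_indicator)
  have "measure (awgn \<sigma> n x) A = (\<integral>z. indicator A z \<partial>awgn \<sigma> n x)"
    using sets.sets_into_space[OF A] by (simp add: awgn_def Int_absorb2)
  also have "\<dots> = (\<integral>z. shift_density x z * indicator A z \<partial>noise \<sigma> n)"
    unfolding awgn_eq_density by (intro integral_real_density) (auto simp: shift_density_pos less_imp_le)
  finally have prob: "(\<integral>z. shift_density x z * indicator A z \<partial>noise \<sigma> n) = measure (awgn \<sigma> n x) A" ..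
  have r_pos: "0 < ?r z" for z
    using assms(2) wide_density_pos[of u z] by (intro add_pos_nonneg) auto
  have "ln (?r z) = ln (wide_density u z) + ln m * indicator A z" for z
  proof (cases "z \<in> A")
    case True
    then have "?r z = m * wide_density u z" by (simp add: algebra_simps)
    with True assms(2) wide_density_pos[of u z] show ?thesis by (simp add: ln_mult)
  qed simp
  then have eq: "shift_density x z * ln (?r z)
      = shift_density x z * ln (wide_density u z) + ln m * (shift_density x z * indicator A z)" for z
    by (simp add: algebra_simps)
  have "(\<integral>z. shift_density x z * ln (?r z) \<partial>noise \<sigma> n) + (\<integral>z. shift_density x z \<partial>noise \<sigma> n)
      - (\<integral>z. ?r z \<partial>noise \<sigma> n) \<le> (\<integral>z. shift_density x z * ln (shift_density x z) \<partial>noise \<sigma> n)"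
    using shift wide int_wide int_shift integrable_wide_density[OF assms(1)]
    by (intro gibbs_inequality r_pos) (auto simp: shift_density_pos less_imp_le integrable_shift_density eq)
  then show ?thesis
    unfolding eq using shift wide int_wide int_shift integrable_wide_density[OF assms(1)]
    by (simp add: prob integral_shift_density integral_wide_density assms(1))
qed

section \<open>Output distribution of a code and its divergence from the noise\<close>

lemma output_dist_eq_density:
  assumes "finite W" "finite K"
  shows "output_dist \<sigma> n W K f = density (noise \<sigma> n) (mixture_density (W \<times> K) f)"
proof (rule measure_eqI)
  show "sets (output_dist \<sigma> n W K f) = sets (density (noise \<sigma> n) (mixture_density (W \<times> K) f))"
    by (simp add: sets_noise)
next
  fix A assume "A \<in> sets (output_dist \<sigma> n W K f)"
  then have A [measurable]: "A \<in> sets (Rn n)" by simp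
  let ?c = "1 / (real (card K) * real (card W))"
  have density: "ennreal (mixture_density (W \<times> K) f z)
      = ennreal ?c * (\<Sum>j\<in>W \<times> K. ennreal (shift_density (f j) z))" for z
    by (simp add: mixture_density_def card_cartesian_product sum_nonneg shift_density_pos
        less_imp_le mult.commute flip: ennreal_mult)
  have "emeasure (density (noise \<sigma> n) (mixture_density (W \<times> K) f)) A
      = (\<integral>\<^sup>+ z. ennreal ?c * (\<Sum>j\<in>W \<times> K. ennreal (shift_density (f j) z) * indicator A z) \<partial>noise \<sigma> n)"
    by (subst emeasure_density) (auto simp: density sum_distrib_right mult.assoc)
  also have "\<dots> = ennreal ?c * (\<Sum>j\<in>W \<times> K. \<integral>\<^sup>+ z. ennreal (shift_density (f j) z) * indicator A z \<partial>noise \<sigma> n)"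
    by (subst nn_integral_cmult) (auto simp: nn_integral_sum)
  also have "\<dots> = ennreal ?c * (\<Sum>j\<in>W \<times> K. emeasure (awgn \<sigma> n (f j)) A)"
    by (simp add: awgn_eq_density emeasure_density)
  also have "(\<Sum>j\<in>W \<times> K. emeasure (awgn \<sigma> n (f j)) A) = (\<Sum>k\<in>K. \<Sum>w\<in>W. emeasure (awgn \<sigma> n (f (w, k))) A)"
    by (rule sum_Times_swap)
  finally show "emeasure (output_dist \<sigma> n W K f) A
      = emeasure (density (noise \<sigma> n) (mixture_density (W \<times> K) f)) A"
    by (simp add: emeasure_output_dist)
qed

text \<open>With base \<open>exp 1\<close> the logarithm is natural, so the covertness constraint
  concerns the integral bounded below in \<open>mixture_relative_entropy_ge\<close>.\<close>

lemma KL_divergence_output_dist: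
  assumes "finite W" "finite K"
  shows "KL_divergence (exp 1) (noise \<sigma> n) (output_dist \<sigma> n W K f)
    = (\<integral>z. mixture_density (W \<times> K) f z * ln (mixture_density (W \<times> K) f z) \<partial>noise \<sigma> n)"
  unfolding output_dist_eq_density[OF assms]
  by (subst noise.KL_density) (auto simp: mixture_density_nonneg log_def)

section \<open>Decoding regions and bounds on the code size\<close>

definition decoding_region :: "((nat \<Rightarrow> real) \<times> 'k \<Rightarrow> 'w) \<Rightarrow> 'w \<Rightarrow> 'k \<Rightarrow> (nat \<Rightarrow> real) set" where
  "decoding_region g w k = {y \<in> space (Rn n). g (y, k) = w}"

lemma sets_decoding_region:
  assumes "is_code n W K f g" "w \<in> W" "k \<in> K"
  shows "decoding_region g w k \<in> sets (Rn n)"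
proof -
  have "(\<lambda>y. g (y, k)) \<in> measurable (Rn n) (count_space W)"
    using assms by (auto simp: is_code_def intro: measurable_compose[OF measurable_Pair1'])
  from measurable_sets[OF this, of "{w}"] assms(2) show ?thesis
    by (simp add: decoding_region_def vimage_def Int_def conj_commute)
qed

text \<open>The channel law is the image of the noise under translation, so the preimage of a
  decoding region is the complement of the error event.\<close>

lemma avg_error_eq:
  assumes code: "is_code n W K f g"
  shows "(\<Sum>k\<in>K. \<Sum>w\<in>W. measure (awgn \<sigma> n (f (w, k))) (decoding_region g w k))
    = real (card K) * real (card W) * (1 - avg_error \<sigma> n W K f g)"
proof -
  have "measure (noise \<sigma> n) {z \<in> space (noise \<sigma> n). g (vec_plus n (f (w, k)) z, k) \<noteq> w}
      = 1 - measure (awgn \<sigma> n (f (w, k))) (decoding_region g w k)" if "w \<in> W" "k \<in> K" for w k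
  proof -
    note A = sets_decoding_region[OF code that]
    let ?B = "vec_plus n (f (w, k)) -` decoding_region g w k \<inter> space (noise \<sigma> n)"
    have "vec_plus n (f (w, k)) z \<in> space (Rn n)" for z
      by (simp add: vec_plus_def space_PiM)
    then have "{z \<in> space (noise \<sigma> n). g (vec_plus n (f (w, k)) z, k) \<noteq> w} = space (noise \<sigma> n) - ?B"
      by (auto simp: decoding_region_def)
    moreover have "?B \<in> sets (noise \<sigma> n)"
      using measurable_vec_plus A by (rule measurable_sets)
    moreover have "measure (awgn \<sigma> n (f (w, k))) (decoding_region g w k) = measure (noise \<sigma> n) ?B"
      unfolding awgn_def using measurable_vec_plus A by (rule measure_distr)
    ultimately show ?thesis by (simp add: noise.prob_compl)
  qed
  then have "(\<Sum>k\<in>K. \<Sum>w\<in>W. measure (noise \<sigma> n) {z \<in> space (noise \<sigma> n). g (vec_plus n (f (w, k)) z, k) \<noteq> w})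
      = real (card K) * real (card W)
        - (\<Sum>k\<in>K. \<Sum>w\<in>W. measure (awgn \<sigma> n (f (w, k))) (decoding_region g w k))"
    by (simp add: sum_subtractf cong: sum.cong)
  moreover have "0 < real (card K)" "0 < real (card W)"
    using code by (auto simp: is_code_def card_gt_0_iff)
  ultimately show ?thesis
    by (simp add: avg_error_def algebra_simps)
qed

text \<open>For a fixed key the decoding regions of distinct messages are disjoint, so their masses
  under \<open>Q\<close> add up to at most 1. This is the success bound \<open>1/M\<close> for an
  output independent of the message.\<close>

lemma sum_wide_density_decoding_region_le:
  assumes code: "is_code n W K f g" and "k \<in> K" "0 \<le> u"
  shows "(\<Sum>w\<in>W. \<integral>z. wide_density u z * indicator (decoding_region g w k) z \<partial>noise \<sigma> n) \<le> 1"
proof -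
  have "finite W" using code by (simp add: is_code_def)
  have int: "integrable (noise \<sigma> n) (\<lambda>z. wide_density u z * indicator (decoding_region g w k) z)"
    if "w \<in> W" for w
    using integrable_wide_density[OF assms(3)] sets_decoding_region[OF code that assms(2)]
    by (intro integrable_real_mult_indicator) (simp_all add: sets_noise)
  have le: "(\<Sum>w\<in>W. wide_density u z * indicator (decoding_region g w k) z) \<le> wide_density u z" for z
  proof -
    \<comment> \<open>Only the region of the decoded message \<open>g (z, k)\<close> can contain
      \<open>z\<close>.\<close>
    have "(\<Sum>w\<in>W. indicator (decoding_region g w k) z :: real) \<le> (\<Sum>w\<in>W. if w = g (z, k) then 1 else 0)"
      by (intro sum_mono) (auto simp: decoding_region_def indicator_def)
    also have "\<dots> \<le> 1" using \<open>finite W\<close> by simp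
    finally show ?thesis
      unfolding sum_distrib_left[symmetric] using wide_density_pos[of u z] by simp
  qed
  have "(\<Sum>w\<in>W. \<integral>z. wide_density u z * indicator (decoding_region g w k) z \<partial>noise \<sigma> n)
      = (\<integral>z. (\<Sum>w\<in>W. wide_density u z * indicator (decoding_region g w k) z) \<partial>noise \<sigma> n)"
    using int by simp
  also have "\<dots> \<le> (\<integral>z. wide_density u z \<partial>noise \<sigma> n)"
    using int integrable_wide_density[OF assms(3)] le by (intro integral_mono) auto
  finally show ?thesis by (simp add: integral_wide_density assms(3))
qed

text \<open>Averages \<open>shift_density_test_bound\<close> over all message-key pairs with
  \<open>m = card W\<close>. By the power hypothesis the energy terms cancel, so the mean of
  \<open>D(P_{Y|X} || Q)\<close> is \<open>n/2 * ln (1 + u)\<close>.\<close>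

lemma code_size_le_capacity:
  assumes code: "is_code n W K f g" and "0 \<le> u"
    and power: "(\<Sum>j\<in>W \<times> K. \<Sum>i<n. (f j i)\<^sup>2) = real (card (W \<times> K)) * (real n * \<sigma>\<^sup>2 * u)"
  shows "(1 - avg_error \<sigma> n W K f g) * ln (real (card W)) \<le> 1 + real n / 2 * ln (1 + u)"
proof -
  define m where "m = real (card W)"
  define N where "N = real (card K) * m"
  define c where "c = u / (2 * \<sigma>\<^sup>2 * (1 + u))"
  have m: "1 \<le> m" and K: "0 < real (card K)"
    using code by (auto simp: is_code_def m_def card_gt_0_iff Suc_le_eq)
  then have N: "0 < N" by (simp add: N_def)
  have c: "c * (\<sigma>\<^sup>2 * (1 + u)) = u / 2"
    using sigma_pos assms(2) by (simp add: c_def divide_simps)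
  have power': "(\<Sum>k\<in>K. \<Sum>w\<in>W. \<Sum>i<n. (f (w, k) i)\<^sup>2) = N * (real n * \<sigma>\<^sup>2 * u)"
    using power by (simp add: sum_Times_swap card_cartesian_product N_def m_def mult_ac)
  define P where "P k w = measure (awgn \<sigma> n (f (w, k))) (decoding_region g w k)" for k w
  define Q where "Q k w = (\<integral>z. wide_density u z * indicator (decoding_region g w k) z \<partial>noise \<sigma> n)" for k w
  have "(\<Sum>k\<in>K. \<Sum>w\<in>W. ln m * P k w - (m - 1) * Q k w)
      \<le> (\<Sum>k\<in>K. \<Sum>w\<in>W. (\<Sum>i<n. (f (w, k) i)\<^sup>2) / (2 * \<sigma>\<^sup>2)
        - c * ((\<Sum>i<n. (f (w, k) i)\<^sup>2) + real n * \<sigma>\<^sup>2) + real n / 2 * ln (1 + u))"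
    unfolding P_def Q_def c_def
    by (intro sum_mono shift_density_test_bound assms(2) m sets_decoding_region[OF code])
  also have "\<dots> = N * (real n * \<sigma>\<^sup>2 * u) / (2 * \<sigma>\<^sup>2) - c * (N * (real n * \<sigma>\<^sup>2 * u) + N * (real n * \<sigma>\<^sup>2))
      + N * (real n / 2 * ln (1 + u))"
    by (simp add: sum.distrib sum_subtractf sum_divide_distrib[symmetric] sum_distrib_left[symmetric]
        power') (simp add: N_def m_def mult.assoc)
  also have "\<dots> = N * (real n * \<sigma>\<^sup>2 * u) / (2 * \<sigma>\<^sup>2) - (c * (\<sigma>\<^sup>2 * (1 + u))) * (N * real n)
      + N * (real n / 2 * ln (1 + u))"
    by (simp add: algebra_simps)
  also have "\<dots> = N * (real n / 2 * ln (1 + u))"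
    unfolding c using sigma_pos by simp
  finally have "ln m * (\<Sum>k\<in>K. \<Sum>w\<in>W. P k w) - (m - 1) * (\<Sum>k\<in>K. \<Sum>w\<in>W. Q k w)
      \<le> N * (real n / 2 * ln (1 + u))"
    by (simp add: sum_subtractf sum_distrib_left[symmetric])
  moreover have "(\<Sum>k\<in>K. \<Sum>w\<in>W. P k w) = N * (1 - avg_error \<sigma> n W K f g)"
    unfolding P_def N_def m_def by (rule avg_error_eq[OF code])
  \<comment> \<open>Each key carries \<open>Q\<close>-mass at most 1, hence the total is at most
    \<open>(m - 1) * card K <= N\<close>. After division by \<open>N\<close> this is the additive 1
    in the bound.\<close>
  moreover have "(m - 1) * (\<Sum>k\<in>K. \<Sum>w\<in>W. Q k w) \<le> N"
  proof -
    have "(\<Sum>k\<in>K. \<Sum>w\<in>W. Q k w) \<le> (\<Sum>k\<in>K. 1)"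
      unfolding Q_def by (intro sum_mono sum_wide_density_decoding_region_le[OF code] assms(2))
    then have "(m - 1) * (\<Sum>k\<in>K. \<Sum>w\<in>W. Q k w) \<le> (m - 1) * real (card K)"
      using m by (intro mult_left_mono) auto
    also have "\<dots> \<le> N" using K by (simp add: N_def algebra_simps)
    finally show ?thesis .
  qed
  ultimately have "N * ((1 - avg_error \<sigma> n W K f g) * ln m) \<le> N * (1 + real n / 2 * ln (1 + u))"
    by (simp add: algebra_simps)
  with N show ?thesis by (simp add: m_def)
qed

text \<open>With \<open>v = ln (1 + u)\<close>, the entropy bound \<open>n/2 * (exp v - 1 - v) \<le> \<delta>\<close> gives \<open>n/4 * v\<^sup>2 \<le> \<delta>\<close>,
  hence \<open>n/2 * v \<le> sqrt (\<delta> * n)\<close>.\<close>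

lemma covert_code_size_le:
  assumes "is_covert_code \<sigma> n M \<epsilon> \<delta> W K f g"
  shows "(1 - \<epsilon>) * ln (real M) \<le> 1 + sqrt (\<delta> * real n)"
proof -
  have code: "is_code n W K f g" and M: "card W = M" and err: "avg_error \<sigma> n W K f g \<le> \<epsilon>"
    and KL: "KL_divergence (exp 1) (noise \<sigma> n) (output_dist \<sigma> n W K f) \<le> \<delta>"
    using assms by (auto simp: is_covert_code_def)
  have fin: "finite W" "finite K" and ne: "W \<noteq> {}" "K \<noteq> {}"
    using code by (auto simp: is_code_def)
  define S where "S = (\<Sum>j\<in>W \<times> K. \<Sum>i<n. (f j i)\<^sup>2)"
  \<comment> \<open>For \<open>n = 0\<close> the divisor vanishes and \<open>u = 0\<close>, which is still the right value.\<close>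
  define u where "u = S / (real (card (W \<times> K)) * (real n * \<sigma>\<^sup>2))"
  define v where "v = ln (1 + u)"
  have "0 \<le> S" by (simp add: S_def sum_nonneg)
  then have u: "0 \<le> u" by (simp add: u_def)
  have power: "(\<Sum>j\<in>W \<times> K. \<Sum>i<n. (f j i)\<^sup>2) = real (card (W \<times> K)) * (real n * \<sigma>\<^sup>2 * u)"
  proof (cases "n = 0")
    case False
    then show ?thesis
      using fin ne sigma_pos by (simp add: S_def[symmetric] u_def card_gt_0_iff)
  qed simp
  have v: "0 \<le> v" and uv: "u = exp v - 1"
    using u by (auto simp: v_def)
  have "real n / 2 * (u - v) \<le> \<delta>"
    using mixture_relative_entropy_ge[OF _ _ u power] KL fin ne
    by (simp add: KL_divergence_output_dist v_def)
  moreover have "v\<^sup>2 / 2 \<le> u - v"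
    using exp_lower_Taylor_quadratic[OF v] by (simp add: uv)
  then have "real n / 2 * (v\<^sup>2 / 2) \<le> real n / 2 * (u - v)"
    by (intro mult_left_mono) auto
  ultimately have "real n / 2 * (v\<^sup>2 / 2) \<le> \<delta>" by linarith
  \<comment> \<open>The factor \<open>n\<close> turns the left side into the square of
    \<open>n/2 * v\<close>.\<close>
  then have "(real n / 2 * (v\<^sup>2 / 2)) * real n \<le> \<delta> * real n"
    by (intro mult_right_mono) auto
  then have "(real n / 2 * v)\<^sup>2 \<le> \<delta> * real n"
    by (simp add: power2_eq_square algebra_simps)
  then have "real n / 2 * v \<le> sqrt (\<delta> * real n)"
    by (rule real_le_rsqrt)
  moreover have "(1 - avg_error \<sigma> n W K f g) * ln (real M) \<le> 1 + real n / 2 * v"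
    using code_size_le_capacity[OF code u power] by (simp add: M v_def)
  \<comment> \<open>This makes \<open>ln M\<close> nonnegative, so the actual error may be replaced
    by the larger \<open>\<epsilon>\<close>.\<close>
  moreover have "1 \<le> real M"
    using fin ne by (simp add: M[symmetric] card_gt_0_iff Suc_le_eq)
  then have "(1 - \<epsilon>) * ln (real M) \<le> (1 - avg_error \<sigma> n W K f g) * ln (real M)"
    using err by (intro mult_right_mono) auto
  ultimately show ?thesis by linarith
qed

section \<open>The maximal code size\<close>

text \<open>Supplies a member of the set whose maximum is \<open>M_star\<close>. The zero codeword
  has likelihood ratio 1, hence divergence 0, and a single message is always decoded
  correctly.\<close>

lemma trivial_covert_code:
  assumes "0 \<le> \<epsilon>" "0 \<le> \<delta>"
  shows "is_covert_code \<sigma> n 1 \<epsilon> \<delta> {0 :: nat} {0 :: nat} (\<lambda>_. \<lambda>i\<in>{..<n}. 0) (\<lambda>_. 0)"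
proof -
  have "mixture_density ({0 :: nat} \<times> {0 :: nat}) (\<lambda>_. \<lambda>i\<in>{..<n}. 0) z = 1" for z
    by (simp add: mixture_density_def shift_density_def)
  then have "KL_divergence (exp 1) (noise \<sigma> n) (output_dist \<sigma> n {0 :: nat} {0 :: nat} (\<lambda>_. \<lambda>i\<in>{..<n}. 0)) = 0"
    by (subst KL_divergence_output_dist) simp_all
  with assms show ?thesis
    by (auto simp: is_covert_code_def is_code_def avg_error_def space_PiM)
qed

lemma M_star_bounds:
  assumes "0 \<le> \<epsilon>" "\<epsilon> < 1" "0 \<le> \<delta>"
  shows "ln (real (M_star \<sigma> n \<epsilon> \<delta>)) \<le> (1 + sqrt (\<delta> * real n)) / (1 - \<epsilon>)"
proof -
  let ?C = "{M. \<exists>(W :: nat set) (K :: nat set) f g. is_covert_code \<sigma> n M \<epsilon> \<delta> W K f g}"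
  have le: "ln (real M) \<le> (1 + sqrt (\<delta> * real n)) / (1 - \<epsilon>)" if "M \<in> ?C" for M
    using that covert_code_size_le assms(2) by (auto simp: pos_le_divide_eq mult.commute)
  \<comment> \<open>\<open>Max\<close> is informative only on a finite nonempty set, so the
    logarithmic bound is turned into an explicit bound on \<open>M\<close>. The case
    \<open>M = 0\<close> is split off because \<open>ln\<close> is inverted only at positive
    arguments.\<close>
  have "M \<le> nat \<lceil>exp ((1 + sqrt (\<delta> * real n)) / (1 - \<epsilon>))\<rceil>" if "M \<in> ?C" for M
  proof (cases "M = 0")
    case False
    then have "real M \<le> exp ((1 + sqrt (\<delta> * real n)) / (1 - \<epsilon>))"
      using le[OF that] by (simp add: ln_le_cancel_iff[symmetric, of "real M"] ln_exp del: ln_le_cancel_iff)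
    then show ?thesis by linarith
  qed simp
  then have "?C \<subseteq> {..nat \<lceil>exp ((1 + sqrt (\<delta> * real n)) / (1 - \<epsilon>))\<rceil>}" by blast
  then have "finite ?C" by (rule finite_subset) simp
  moreover have "1 \<in> ?C" using trivial_covert_code[OF assms(1,3)] by blast
  ultimately have "Max ?C \<in> ?C" by (intro Max_in) blast+
  then show ?thesis unfolding M_star_def by (rule le)
qed

end

section \<open>Passage to the limit in the blocklength\<close>

theorem proposition1:
  fixes \<sigma> \<epsilon> \<delta> :: real
  assumes "\<sigma> > 0" and "0 < \<epsilon>" and "\<epsilon> < 1" and "0 < \<delta>" and "\<delta> \<le> 1"
  shows "covert_capacity \<sigma> \<epsilon> \<delta> \<le> ereal (sqrt \<delta> / (1 - \<epsilon>))"
proof -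
  \<comment> \<open>The bound of \<open>M_star_bounds\<close> divided by \<open>sqrt n\<close>: only
    the additive 1 still depends on \<open>n\<close>, and it vanishes in the limit.\<close>
  let ?b = "\<lambda>n. (1 / sqrt (real n) + sqrt \<delta>) / (1 - \<epsilon>)"
  have "(\<lambda>n. 1 / sqrt (real n)) \<longlonglongrightarrow> 0"
    using tendsto_inverse_0_at_top[OF filterlim_compose[OF sqrt_at_top filterlim_real_sequentially]]
    by (simp add: divide_inverse)
  then have "(\<lambda>n. ereal (?b n)) \<longlonglongrightarrow> ereal ((0 + sqrt \<delta>) / (1 - \<epsilon>))"
    using assms(3) by (intro tendsto_intros lim_ereal[THEN iffD2]) auto
  then have lim: "liminf (\<lambda>n. ereal (?b n)) = ereal (sqrt \<delta> / (1 - \<epsilon>))"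
    by (simp add: lim_imp_Liminf)
  \<comment> \<open>At \<open>n = 0\<close> division by \<open>sqrt 0\<close> yields 0 and the
    rewriting to \<open>?b n\<close> fails; for the limit inferior all \<open>n\<close> from 1 on
    suffice.\<close>
  have "ln (real (M_star \<sigma> n \<epsilon> \<delta>)) / sqrt (real n) \<le> ?b n" if "0 < n" for n
  proof -
    interpret gaussian_noise \<sigma> n by unfold_locales (rule assms)
    have "ln (real (M_star \<sigma> n \<epsilon> \<delta>)) / sqrt (real n)
        \<le> (1 + sqrt (\<delta> * real n)) / (1 - \<epsilon>) / sqrt (real n)"
      using assms by (intro divide_right_mono M_star_bounds) auto
    also have "\<dots> = ?b n"
      using that by (simp add: real_sqrt_mult add_divide_distrib mult.commute)
    finally show ?thesis .
  qed
  then have "covert_capacity \<sigma> \<epsilon> \<delta> \<le> liminf (\<lambda>n. ereal (?b n))"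
    unfolding covert_capacity_def
    by (intro Liminf_mono) (auto simp: eventually_sequentially intro!: exI[of _ 1])
  then show ?thesis by (simp add: lim)
qed

end
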